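(* For every $A \subseteq \omega$, the set $\mathcal{R}(A) = \bigcup_{n \in A} R_n$ is Turing equivalent to $A$, and $\mathcal{R}(A)$ is generically computable if and only if $A$ is computable. Hence, every nonzero Turing degree contains a subset of $\omega$ which is not generically computable.
   Context: $\omega = \{0,1,2,\dots\}$. For $k \in \omega$, $R_k = \{ m \in \omega : 2^k \mid m,\ 2^{k+1} \nmid m \}$. The density of $S \subseteq \omega$ is $\rho(S) = \lim_{n\to\infty} \frac{|S \cap [0,n]|}{n+1}$, when this limit exists. A generic description of $S \subseteq \omega$ is a partial function $\Phi$ from $\omega$ to $\{0,1\}$ such that $\Phi(x) = \chi_S(x)$ whenever $\Phi(x)$ is defined and the domain of $\Phi$ has density $1$; here $\chi_S$ is the characteristic function of $S$. $S$ is generically computable if it has a generic description which is a partial computable function. A Turing degree is nonzero if it is not the degree of the computable sets. *)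

theory Defs
  imports Complex_Main "HOL-Library.Indicator_Function"
begin

subsection \<open>Relative computability\<close>

text \<open>A partial function of any number of arguments is a map \<open>nat list \<rightharpoonup> nat\<close>. The
  arity of a function is not recorded: the values on lists of length \<open>n\<close> are an \<open>n\<close>-ary
  partial function, and only these matter when \<open>n\<close> arguments are supplied.\<close>

definition unary :: "(nat \<rightharpoonup> nat) \<Rightarrow> nat list \<rightharpoonup> nat" where
  "unary h xs = (case xs of [x] \<Rightarrow> h x | _ \<Rightarrow> None)"

definition proj :: "nat \<Rightarrow> nat list \<rightharpoonup> nat" where
  "proj i xs = (if i < length xs then Some (xs ! i) else None)"

definition comp :: "(nat list \<rightharpoonup> nat) \<Rightarrow> (nat list \<rightharpoonup> nat) list \<Rightarrow> nat list \<rightharpoonup> nat" where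
  "comp f gs xs = Option.bind (those (map (\<lambda>g. g xs) gs)) f"

fun prim_rec_aux :: "(nat list \<rightharpoonup> nat) \<Rightarrow> (nat list \<rightharpoonup> nat) \<Rightarrow> nat \<Rightarrow> nat list \<rightharpoonup> nat" where
  "prim_rec_aux f g 0 xs = f xs"
| "prim_rec_aux f g (Suc n) xs = Option.bind (prim_rec_aux f g n xs) (\<lambda>y. g (n # y # xs))"

definition prim_rec :: "(nat list \<rightharpoonup> nat) \<Rightarrow> (nat list \<rightharpoonup> nat) \<Rightarrow> nat list \<rightharpoonup> nat" where
  "prim_rec f g xs = (case xs of [] \<Rightarrow> None | n # ys \<Rightarrow> prim_rec_aux f g n ys)"

text \<open>Unbounded minimisation: the search diverges if some value is undefined before a zero
  is found.\<close>

definition minimise :: "(nat list \<rightharpoonup> nat) \<Rightarrow> nat list \<rightharpoonup> nat" where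
  "minimise f xs =
     (if \<exists>n. f (n # xs) = Some 0 \<and> (\<forall>m<n. \<exists>y. f (m # xs) = Some (Suc y))
      then Some (LEAST n. f (n # xs) = Some 0) else None)"

text \<open>Kleene's partial recursive functions relative to a set of total oracle functions; the
  empty set of oracles gives the partial recursive functions.\<close>

inductive partrec_in :: "(nat \<Rightarrow> nat) set \<Rightarrow> (nat list \<rightharpoonup> nat) \<Rightarrow> bool" for Orc where
  zero: "partrec_in Orc (\<lambda>xs. Some 0)"
| succ: "partrec_in Orc (unary (\<lambda>x. Some (Suc x)))"
| proj: "partrec_in Orc (proj i)"
| query: "h \<in> Orc \<Longrightarrow> partrec_in Orc (unary (\<lambda>x. Some (h x)))"
| comp: "partrec_in Orc f \<Longrightarrow> \<forall>g\<in>set gs. partrec_in Orc g \<Longrightarrow> partrec_in Orc (comp f gs)"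
| prim_rec: "partrec_in Orc f \<Longrightarrow> partrec_in Orc g \<Longrightarrow> partrec_in Orc (prim_rec f g)"
| minimise: "partrec_in Orc f \<Longrightarrow> partrec_in Orc (minimise f)"

definition partial_computable_in :: "(nat \<Rightarrow> nat) set \<Rightarrow> (nat \<rightharpoonup> nat) \<Rightarrow> bool" where
  "partial_computable_in Orc \<phi> \<longleftrightarrow> (\<exists>f. partrec_in Orc f \<and> (\<forall>x. f [x] = \<phi> x))"

definition partial_computable :: "(nat \<rightharpoonup> nat) \<Rightarrow> bool" where
  "partial_computable \<phi> \<longleftrightarrow> partial_computable_in {} \<phi>"

definition computable_set :: "nat set \<Rightarrow> bool" where
  "computable_set A \<longleftrightarrow> partial_computable (\<lambda>x. Some (indicator A x))"

definition turing_reducible :: "nat set \<Rightarrow> nat set \<Rightarrow> bool"  (infix "\<le>\<^sub>T" 50) where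
  "A \<le>\<^sub>T B \<longleftrightarrow> partial_computable_in {indicator B} (\<lambda>x. Some (indicator A x))"

definition turing_equivalent :: "nat set \<Rightarrow> nat set \<Rightarrow> bool"  (infix "\<equiv>\<^sub>T" 50) where
  "A \<equiv>\<^sub>T B \<longleftrightarrow> A \<le>\<^sub>T B \<and> B \<le>\<^sub>T A"

definition turing_degrees :: "nat set set set" where
  "turing_degrees = UNIV // {(A, B). A \<equiv>\<^sub>T B}"

definition zero_degree :: "nat set set" where
  "zero_degree = {A. computable_set A}"

subsection \<open>Generic computability\<close>

definition has_density :: "nat set \<Rightarrow> real \<Rightarrow> bool" where
  "has_density S d \<longleftrightarrow> (\<lambda>n. real (card (S \<inter> {0..n})) / real (n + 1)) \<longlonglongrightarrow> d"

definition generic_description :: "(nat \<rightharpoonup> nat) \<Rightarrow> nat set \<Rightarrow> bool" where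
  "generic_description \<Phi> S \<longleftrightarrow>
     ran \<Phi> \<subseteq> {0, 1} \<and> (\<forall>x\<in>dom \<Phi>. \<Phi> x = Some (indicator S x)) \<and> has_density (dom \<Phi>) 1"

definition generically_computable :: "nat set \<Rightarrow> bool" where
  "generically_computable S \<longleftrightarrow> (\<exists>\<Phi>. generic_description \<Phi> S \<and> partial_computable \<Phi>)"

definition Rk :: "nat \<Rightarrow> nat set" where
  "Rk k = {m. 2 ^ k dvd m \<and> \<not> 2 ^ (k + 1) dvd m}"

definition calR :: "nat set \<Rightarrow> nat set" where
  "calR A = (\<Union>n\<in>A. Rk n)"

subsection \<open>Turing degrees are well defined\<close>

lemma prim_rec_aux_pred: "prim_rec_aux (\<lambda>xs. Some 0) (proj 0) n [] = Some (n - 1)"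
  by (induction n) (auto simp: proj_def)

lemma unary_id: "comp (prim_rec (\<lambda>xs. Some 0) (proj 0)) [unary (\<lambda>x. Some (Suc x))] = unary Some"
  by (rule ext)
     (auto simp: comp_def prim_rec_def unary_def proj_def prim_rec_aux_pred split: list.splits)

lemma partrec_in_unary:
  assumes "partial_computable_in Orc \<phi>"
  shows "partrec_in Orc (unary \<phi>)"
proof -
  obtain f where f: "partrec_in Orc f" "\<And>x. f [x] = \<phi> x"
    using assms by (auto simp: partial_computable_in_def)
  have id: "partrec_in Orc (unary Some)"
    unfolding unary_id[symmetric] by (auto intro!: partrec_in.intros)
  have "comp f [unary Some] = unary \<phi>"
    by (rule ext) (auto simp: comp_def unary_def f(2) split: list.splits)
  moreover have "partrec_in Orc (comp f [unary Some])"
    using f(1) id by (intro partrec_in.comp) auto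
  ultimately show ?thesis by simp
qed

lemma partrec_in_trans:
  assumes "partrec_in Orc f"
    and "\<And>h. h \<in> Orc \<Longrightarrow> partial_computable_in Orc' (\<lambda>x. Some (h x))"
  shows "partrec_in Orc' f"
  using assms(1)
  by induction (auto intro: partrec_in.intros partrec_in_unary assms(2))

lemma partial_computable_in_trans:
  assumes "partial_computable_in Orc \<phi>"
    and "\<And>h. h \<in> Orc \<Longrightarrow> partial_computable_in Orc' (\<lambda>x. Some (h x))"
  shows "partial_computable_in Orc' \<phi>"
  using assms partrec_in_trans unfolding partial_computable_in_def by metis

lemma turing_reducible_refl: "A \<le>\<^sub>T A"
  unfolding turing_reducible_def partial_computable_in_def
  by (rule exI[of _ "unary (\<lambda>x. Some (indicator A x))"])
     (auto intro!: partrec_in.query simp: unary_def)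

lemma turing_reducible_trans: "A \<le>\<^sub>T B \<Longrightarrow> B \<le>\<^sub>T C \<Longrightarrow> A \<le>\<^sub>T C"
  unfolding turing_reducible_def by (erule partial_computable_in_trans) auto

lemma equiv_turing: "equiv UNIV {(A, B). A \<equiv>\<^sub>T B}"
  by (rule equivI)
     (auto simp: refl_on_def sym_def trans_def turing_equivalent_def
       intro: turing_reducible_refl turing_reducible_trans)

lemma computable_set_reducible: "computable_set A \<Longrightarrow> A \<le>\<^sub>T B"
  unfolding computable_set_def partial_computable_def turing_reducible_def
  by (erule partial_computable_in_trans) auto

lemma reducible_computable_set: "A \<le>\<^sub>T B \<Longrightarrow> computable_set B \<Longrightarrow> computable_set A"
  unfolding computable_set_def partial_computable_def turing_reducible_def
  by (erule partial_computable_in_trans) auto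

lemma computable_set_empty: "computable_set {}"
  unfolding computable_set_def partial_computable_def partial_computable_in_def
  by (rule exI[of _ "\<lambda>xs. Some 0"]) (auto intro: partrec_in.zero)

lemma zero_degree_in_turing_degrees: "zero_degree \<in> turing_degrees"
proof -
  have "zero_degree = {(A, B). A \<equiv>\<^sub>T B} `` {{}}"
    using computable_set_empty
    by (auto simp: zero_degree_def turing_equivalent_def
        intro: computable_set_reducible reducible_computable_set)
  then show ?thesis unfolding turing_degrees_def by (metis UNIV_I quotientI)
qed

end

theory Submission
  imports Defs
begin

text \<open>
  A number lies in \<open>R\<^sub>n\<close> exactly if it has the form \<open>2\<^sup>n (2j + 1)\<close>, so \<open>R\<^sub>n\<close> has the positive
  density \<open>2\<^sup>-\<^sup>(\<^sup>n\<^sup>+\<^sup>1\<^sup>)\<close>, and every domain of density 1 meets every \<open>R\<^sub>n\<close>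
  (\<open>density_one_meets_Rk\<close>). A single value of a generic description of \<open>\<R>(A)\<close> on \<open>R\<^sub>n\<close> already
  tells whether \<open>n \<in> A\<close>. A computable generic description \<open>\<Phi>\<close> therefore gives a decision
  procedure for \<open>A\<close>: on input \<open>n\<close>, search \<open>R\<^sub>n\<close> for a point where \<open>\<Phi>\<close> converges, and output the
  value of \<open>\<Phi>\<close> there. Such a point always exists, so the search ends.

  The search must dovetail, since \<open>\<Phi>\<close> may diverge at any particular point. In place of a
  universal machine, \<open>stage_approximation\<close> shows, by induction on the generation of a partial
  recursive \<open>f\<close>, that there is a total recursive \<open>F\<close> such that \<open>F(s, x)\<close> is 0 (no answer at stage
  \<open>s\<close>) or the successor of the value \<open>f(x)\<close>, and is the latter for all large \<open>s\<close> if \<open>f(x)\<close> is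
  defined. The search then looks for a stage \<open>t\<close> such that \<open>F(t, 2\<^sup>n (2j + 1)) \<noteq> 0\<close> for some
  \<open>j < t\<close>.

  The Turing equivalence of \<open>\<R>(A)\<close> and \<open>A\<close> is the pair of reductions
  \<open>n \<in> A \<longleftrightarrow> 2\<^sup>n \<in> \<R>(A)\<close> and \<open>m \<in> \<R>(A) \<longleftrightarrow> (\<exists>n, j < m. n \<in> A \<and> m = 2\<^sup>n (2j + 1))\<close>. In a nonzero
  degree, \<open>\<R>(A)\<close> for any member \<open>A\<close> is thus a member that is not generically computable.
\<close>

section \<open>Total recursive functions of fixed arity\<close>

text \<open>Fixing the arity removes the undefined cases of the untyped argument lists; the functions
  \<open>h\<close> are ordinary HOL functions of the argument list, so that their recursiveness can be read off
  the term that defines them.\<close>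

definition recursive_in :: "(nat \<Rightarrow> nat) set \<Rightarrow> nat \<Rightarrow> (nat list \<Rightarrow> nat) \<Rightarrow> bool" where
  "recursive_in Orc k h \<longleftrightarrow> (\<exists>f. partrec_in Orc f \<and> (\<forall>xs. length xs = k \<longrightarrow> f xs = Some (h xs)))"

definition recursive_vec_in :: "(nat \<Rightarrow> nat) set \<Rightarrow> nat \<Rightarrow> nat \<Rightarrow> (nat list \<Rightarrow> nat list) \<Rightarrow> bool" where
  "recursive_vec_in Orc k n v \<longleftrightarrow>
     (\<forall>xs. length xs = k \<longrightarrow> length (v xs) = n) \<and> (\<forall>i<n. recursive_in Orc k (\<lambda>xs. v xs ! i))"

lemma recursive_cong:
  assumes "recursive_in Orc k f" "\<And>xs. length xs = k \<Longrightarrow> f xs = g xs"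
  shows "recursive_in Orc k g"
  using assms unfolding recursive_in_def by metis

lemma recursive_unary_iff:
  "partial_computable_in Orc (\<lambda>x. Some (h x)) \<longleftrightarrow> recursive_in Orc (Suc 0) (\<lambda>xs. h (xs ! 0))"
  unfolding partial_computable_in_def recursive_in_def by (auto simp: length_Suc_conv)

lemma recursive_comp:
  assumes "recursive_in Orc n f" "recursive_vec_in Orc k n v"
  shows "recursive_in Orc k (\<lambda>xs. f (v xs))"
proof -
  obtain p where p: "partrec_in Orc p" "\<And>xs. length xs = n \<Longrightarrow> p xs = Some (f xs)"
    using assms(1) unfolding recursive_in_def by blast
  have len: "length (v xs) = n" if "length xs = k" for xs
    using assms(2) that unfolding recursive_vec_in_def by blast
  have "\<forall>i<n. \<exists>g. partrec_in Orc g \<and> (\<forall>xs. length xs = k \<longrightarrow> g xs = Some (v xs ! i))"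
    using assms(2) unfolding recursive_vec_in_def recursive_in_def by blast
  then obtain q where q: "\<And>i. i < n \<Longrightarrow> partrec_in Orc (q i)"
      "\<And>i xs. i < n \<Longrightarrow> length xs = k \<Longrightarrow> q i xs = Some (v xs ! i)"
    by metis
  have those_Some: "those (map Some ys) = Some ys" for ys :: "nat list"
    by (induction ys) auto
  have "comp p (map q [0..<n]) xs = Some (f (v xs))" if xs: "length xs = k" for xs
  proof -
    have "map (\<lambda>g. g xs) (map q [0..<n]) = map Some (v xs)"
      using len[OF xs] by (intro nth_equalityI) (auto simp: q(2)[OF _ xs])
    then show ?thesis
      by (simp only: comp_def those_Some) (simp add: p(2) len[OF xs])
  qed
  moreover have "partrec_in Orc (comp p (map q [0..<n]))"
    by (rule partrec_in.comp) (auto simp: p q)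
  ultimately show ?thesis unfolding recursive_in_def by blast
qed

lemma recursive_vec_id: "recursive_vec_in Orc k k (\<lambda>xs. xs)"
  unfolding recursive_vec_in_def recursive_in_def
  by (auto intro: exI[of _ "proj _"] partrec_in.proj simp: proj_def)

lemma recursive_nth: "i < k \<Longrightarrow> recursive_in Orc k (\<lambda>xs. xs ! i)"
  using recursive_vec_id by (simp add: recursive_vec_in_def)

lemma recursive_vec_Nil: "recursive_vec_in Orc k 0 (\<lambda>xs. [])"
  by (simp add: recursive_vec_in_def)

lemma recursive_vec_Cons:
  "recursive_in Orc k f \<Longrightarrow> recursive_vec_in Orc k n v \<Longrightarrow>
   recursive_vec_in Orc k (Suc n) (\<lambda>xs. f xs # v xs)"
  unfolding recursive_vec_in_def by (auto simp: less_Suc_eq_0_disj)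

lemma recursive_vec_tl:
  assumes "recursive_vec_in Orc k (Suc n) v"
  shows "recursive_vec_in Orc k n (\<lambda>xs. tl (v xs))"
  unfolding recursive_vec_in_def
proof (intro conjI allI impI)
  fix i assume "i < n"
  then have "recursive_in Orc k (\<lambda>xs. v xs ! Suc i)"
    using assms by (simp add: recursive_vec_in_def)
  then show "recursive_in Orc k (\<lambda>xs. tl (v xs) ! i)"
    by (rule recursive_cong)
       (use assms \<open>i < n\<close> in \<open>auto simp: recursive_vec_in_def nth_tl\<close>)
qed (use assms in \<open>auto simp: recursive_vec_in_def\<close>)

lemma recursive_vec_map:
  "(\<And>g. g \<in> set gs \<Longrightarrow> recursive_in Orc k g) \<Longrightarrow>
   recursive_vec_in Orc k (length gs) (\<lambda>xs. map (\<lambda>g. g xs) gs)"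
  unfolding recursive_vec_in_def by (auto intro: recursive_cong)

lemma recursive_weaken:
  assumes "recursive_in Orc k f"
  shows "recursive_in Orc (Suc k) (\<lambda>ys. f (tl ys))"
  by (rule recursive_comp[OF assms recursive_vec_tl[OF recursive_vec_id]])

text \<open>The closure rules are applied backwards to a term in the argument list. A bound variable of a
  recursion, a bounded quantifier or a minimisation is the head of an extended list, and the former
  arguments are its tail; weakening moves a fact about the former arguments below the new one.\<close>

lemmas recursive_args =
  recursive_nth recursive_weaken recursive_vec_id recursive_vec_Nil recursive_vec_Cons recursive_vec_tl

lemma recursive_unary:
  assumes "partrec_in Orc (unary (\<lambda>x. Some (h x)))" "recursive_in Orc k n"
  shows "recursive_in Orc k (\<lambda>xs. h (n xs))"
proof -
  have "recursive_in Orc (Suc 0) (\<lambda>ys. h (ys ! 0))"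
    unfolding recursive_unary_iff[symmetric] partial_computable_in_def
    using assms(1) by (auto simp: unary_def)
  from recursive_comp[OF this recursive_vec_Cons[OF assms(2) recursive_vec_Nil]]
  show ?thesis by simp
qed

lemmas recursive_Suc = recursive_unary[OF partrec_in.succ]

lemmas recursive_query = recursive_unary[OF partrec_in.query]

lemma recursive_const: "recursive_in Orc k (\<lambda>xs. c)"
proof (induction c)
  case 0
  show ?case unfolding recursive_in_def using partrec_in.zero by blast
qed (rule recursive_Suc)

text \<open>Primitive recursion, with \<open>m\<close> the counter, \<open>y\<close> the previous value and \<open>tl (tl ys)\<close> the
  parameters.\<close>

lemma recursive_rec_nat:
  assumes b: "recursive_in Orc k b" and n: "recursive_in Orc k n"
    and st: "recursive_in Orc (Suc (Suc k)) (\<lambda>ys. st (ys ! 0) (ys ! 1) (tl (tl ys)))"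
  shows "recursive_in Orc k (\<lambda>xs. rec_nat (b xs) (\<lambda>m y. st m y xs) (n xs))"
proof -
  obtain p where p: "partrec_in Orc p" "\<And>xs. length xs = k \<Longrightarrow> p xs = Some (b xs)"
    using b unfolding recursive_in_def by blast
  obtain q where q: "partrec_in Orc q"
      "\<And>ys. length ys = Suc (Suc k) \<Longrightarrow> q ys = Some (st (ys ! 0) (ys ! 1) (tl (tl ys)))"
    using st unfolding recursive_in_def by blast
  let ?R = "\<lambda>ys. rec_nat (b (tl ys)) (\<lambda>m y. st m y (tl ys)) (ys ! 0)"
  have aux: "prim_rec_aux p q m xs = Some (rec_nat (b xs) (\<lambda>m y. st m y xs) m)"
    if "length xs = k" for m xs
    using that by (induction m) (auto simp: p q)
  have "recursive_in Orc (Suc k) ?R"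
    unfolding recursive_in_def
    by (rule exI[of _ "prim_rec p q"])
       (auto simp: p q aux prim_rec_def length_Suc_conv intro: partrec_in.prim_rec)
  from recursive_comp[OF this recursive_vec_Cons[OF n recursive_vec_id]]
  show ?thesis by simp
qed

lemma recursive_if:
  assumes "recursive_in Orc k c" "recursive_in Orc k a" "recursive_in Orc k b"
  shows "recursive_in Orc k (\<lambda>xs. if c xs = 0 then a xs else b xs)"
proof -
  have "recursive_in Orc k (\<lambda>xs. rec_nat (a xs) (\<lambda>m y. b xs) (c xs))"
    by (intro recursive_rec_nat recursive_weaken assms)
  then show ?thesis
    by (rule recursive_cong) (auto simp: gr0_conv_Suc)
qed

lemma recursive_add:
  assumes "recursive_in Orc k a" "recursive_in Orc k b"
  shows "recursive_in Orc k (\<lambda>xs. a xs + b xs)"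
proof -
  have eq: "rec_nat x (\<lambda>m y. Suc y) n = x + n" for x n :: nat
    by (induction n) auto
  have "recursive_in Orc k (\<lambda>xs. rec_nat (a xs) (\<lambda>m y. Suc y) (b xs))"
    by (intro recursive_rec_nat recursive_Suc recursive_args assms) auto
  then show ?thesis by (simp add: eq)
qed

lemma recursive_mult:
  assumes "recursive_in Orc k a" "recursive_in Orc k b"
  shows "recursive_in Orc k (\<lambda>xs. a xs * b xs)"
proof -
  have eq: "rec_nat 0 (\<lambda>m y. y + x) n = x * n" for x n :: nat
    by (induction n) auto
  have "recursive_in Orc k (\<lambda>xs. rec_nat 0 (\<lambda>m y. y + a xs) (b xs))"
    by (intro recursive_rec_nat recursive_add recursive_const recursive_args assms)
       auto
  then show ?thesis by (simp add: eq)
qed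

lemma recursive_power2:
  assumes "recursive_in Orc k a"
  shows "recursive_in Orc k (\<lambda>xs. 2 ^ a xs)"
proof -
  have eq: "rec_nat 1 (\<lambda>m y. 2 * y) n = 2 ^ n" for n :: nat
    by (induction n) auto
  have "recursive_in Orc k (\<lambda>xs. rec_nat 1 (\<lambda>m y. 2 * y) (a xs))"
    by (intro recursive_rec_nat recursive_mult recursive_const recursive_args assms) auto
  then show ?thesis by (simp only: eq)
qed

lemma recursive_pred:
  assumes "recursive_in Orc k a"
  shows "recursive_in Orc k (\<lambda>xs. a xs - 1)"
proof -
  have eq: "rec_nat 0 (\<lambda>m y. m) n = n - 1" for n :: nat
    by (cases n) auto
  have "recursive_in Orc k (\<lambda>xs. rec_nat 0 (\<lambda>m y. m) (a xs))"
    by (intro recursive_rec_nat recursive_const recursive_args assms) auto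
  then show ?thesis by (simp add: eq)
qed

lemma recursive_diff:
  assumes "recursive_in Orc k a" "recursive_in Orc k b"
  shows "recursive_in Orc k (\<lambda>xs. a xs - b xs)"
proof -
  have eq: "rec_nat x (\<lambda>m y. y - 1) n = x - n" for x n :: nat
    by (induction n) auto
  have "recursive_in Orc k (\<lambda>xs. rec_nat (a xs) (\<lambda>m y. y - 1) (b xs))"
    by (intro recursive_rec_nat recursive_pred recursive_args assms) auto
  then show ?thesis by (simp only: eq)
qed

lemma recursive_prod_list:
  assumes "\<And>g. g \<in> set gs \<Longrightarrow> recursive_in Orc k g"
  shows "recursive_in Orc k (\<lambda>xs. \<Prod>g\<leftarrow>gs. g xs)"
  using assms by (induction gs) (auto intro: recursive_const recursive_mult)

lemma recursive_not:
  assumes "recursive_in Orc k (\<lambda>xs. of_bool (P xs))"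
  shows "recursive_in Orc k (\<lambda>xs. of_bool (\<not> P xs))"
  by (rule recursive_cong[OF recursive_if[OF assms recursive_const recursive_const, of 1 0]]) auto

lemma recursive_conj:
  assumes "recursive_in Orc k (\<lambda>xs. of_bool (P xs))" "recursive_in Orc k (\<lambda>xs. of_bool (Q xs))"
  shows "recursive_in Orc k (\<lambda>xs. of_bool (P xs \<and> Q xs))"
  by (rule recursive_cong[OF recursive_mult[OF assms]]) auto

lemma recursive_eq:
  assumes "recursive_in Orc k a" "recursive_in Orc k b"
  shows "recursive_in Orc k (\<lambda>xs. of_bool (a xs = b xs))"
proof -
  have "recursive_in Orc k (\<lambda>xs. if (a xs - b xs) + (b xs - a xs) = 0 then 1 else 0)"
    by (intro recursive_if recursive_add recursive_diff recursive_const assms)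
  then show ?thesis by (rule recursive_cong) auto
qed

lemma recursive_bounded_ex:
  assumes "recursive_in Orc k b"
    and "recursive_in Orc (Suc k) (\<lambda>ys. of_bool (P (ys ! 0) (tl ys)))"
  shows "recursive_in Orc k (\<lambda>xs. of_bool (\<exists>i<b xs. P i xs))"
proof -
  have eq: "rec_nat 0 (\<lambda>m y. if y = 0 then of_bool (Q m) else 1) n = (of_bool (\<exists>i<n. Q i) :: nat)"
    for Q :: "nat \<Rightarrow> bool" and n
    by (induction n) (auto simp: less_Suc_eq)
  have P: "recursive_in Orc (Suc (Suc k)) (\<lambda>ys. of_bool (P (ys ! 0) (tl (tl ys))))"
  proof -
    have "recursive_vec_in Orc (Suc (Suc k)) (Suc k) (\<lambda>ys. ys ! 0 # tl (tl ys))"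
      by (intro recursive_args) auto
    from recursive_comp[OF assms(2) this] show ?thesis by simp
  qed
  have "recursive_in Orc k
      (\<lambda>xs. rec_nat 0 (\<lambda>m y. if y = 0 then of_bool (P m xs) else 1) (b xs))"
    by (intro recursive_rec_nat recursive_if recursive_const recursive_args assms P) auto
  then show ?thesis by (simp only: eq)
qed

text \<open>Minimisation of a total predicate that has a witness for all parameters stays within the total
  functions.\<close>

lemma recursive_Least:
  assumes "recursive_in Orc (Suc k) (\<lambda>ys. of_bool (P (ys ! 0) (tl ys)))"
    and ex: "\<And>xs. length xs = k \<Longrightarrow> \<exists>n. P n xs"
  shows "recursive_in Orc k (\<lambda>xs. LEAST n. P n xs)"
proof -
  obtain p where p: "partrec_in Orc p"
      "\<And>ys. length ys = Suc k \<Longrightarrow> p ys = Some (of_bool (\<not> P (ys ! 0) (tl ys)))"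
    using recursive_not[OF assms(1)] unfolding recursive_in_def by blast
  have "minimise p xs = Some (LEAST n. P n xs)" if xs: "length xs = k" for xs
  proof -
    have p0: "p (n # xs) = Some 0 \<longleftrightarrow> P n xs" for n
      using p(2)[of "n # xs"] xs by simp
    have p1: "(\<exists>y. p (n # xs) = Some (Suc y)) \<longleftrightarrow> \<not> P n xs" for n
      using p(2)[of "n # xs"] xs by (cases "P n xs") auto
    have "P (LEAST n. P n xs) xs" using ex[OF xs] by (rule LeastI_ex)
    moreover have "\<forall>m < (LEAST n. P n xs). \<not> P m xs" using not_less_Least by blast
    ultimately have "\<exists>n. P n xs \<and> (\<forall>m<n. \<not> P m xs)" by blast
    then show ?thesis by (simp only: minimise_def p0 p1 if_True)
  qed
  then show ?thesis unfolding recursive_in_def using partrec_in.minimise[OF p(1)] by blast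
qed

section \<open>Approximating a partial recursive function in stages\<close>

text \<open>The sequence \<open>a\<close> approximates the possibly undefined value \<open>v\<close>: 0 means that there is no answer
  yet, and \<open>Suc y\<close> is the answer \<open>y\<close>. An answer may be withdrawn at a later stage, as long as it is
  never wrong and is eventually permanent if \<open>v\<close> is defined. Asking for \<open>eventually\<close> instead of
  monotonicity in \<open>s\<close> lets finitely many approximations be combined without further care.\<close>

definition reveals :: "(nat \<Rightarrow> nat) \<Rightarrow> nat option \<Rightarrow> bool" where
  "reveals a v \<longleftrightarrow> (\<forall>s y. a s = Suc y \<longrightarrow> v = Some y) \<and>
     (\<forall>y. v = Some y \<longrightarrow> (\<forall>\<^sub>F s in sequentially. a s = Suc y))"

lemma reveals_None: "reveals (\<lambda>s. 0) None"
  by (simp add: reveals_def)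

lemma reveals_Some: "reveals (\<lambda>s. Suc y) (Some y)"
  by (simp add: reveals_def)

text \<open>Substitution of one partial computation into another is the bind of the option monad, so this
  one rule serves both composition and the steps of a primitive recursion.\<close>

lemma reveals_bind:
  assumes "reveals a v" "\<And>y. reveals (\<lambda>s. b s y) (w y)"
  shows "reveals (\<lambda>s. if a s = 0 then 0 else b s (a s - 1)) (Option.bind v w)"
  unfolding reveals_def
proof (intro conjI allI impI)
  fix s z assume "(if a s = 0 then 0 else b s (a s - 1)) = Suc z"
  then obtain y where "a s = Suc y" "b s y = Suc z" by (cases "a s") auto
  then show "Option.bind v w = Some z" using assms unfolding reveals_def by auto
next
  fix z assume "Option.bind v w = Some z"
  then obtain y where "v = Some y" "w y = Some z" by (cases v) auto
  then have "\<forall>\<^sub>F s in sequentially. a s = Suc y" "\<forall>\<^sub>F s in sequentially. b s y = Suc z"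
    using assms unfolding reveals_def by auto
  then show "\<forall>\<^sub>F s in sequentially. (if a s = 0 then 0 else b s (a s - 1)) = Suc z"
    by eventually_elim auto
qed

text \<open>A product of natural numbers is nonzero exactly if all factors are: this tests whether all
  arguments have been answered. The proof peels off one argument at a time with the bind rule, hence
  the generalisation over \<open>f\<close> and \<open>F\<close>.\<close>

lemma reveals_comp:
  assumes "length Gs = length gs" "\<And>i. i < length gs \<Longrightarrow> reveals (Gs ! i) ((gs ! i) xs)"
    and "\<And>ys. length ys = length gs \<Longrightarrow> reveals (\<lambda>s. F (s # ys)) (f ys)"
  shows "reveals (\<lambda>s. if (\<Prod>G\<leftarrow>Gs. G s) = 0 then 0 else F (s # map (\<lambda>G. G s - 1) Gs)) (comp f gs xs)"
  using assms
proof (induction gs arbitrary: Gs f F)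
  case Nil
  then show ?case by (simp add: comp_def)
next
  case (Cons g gs)
  then obtain G Gs' where Gs: "Gs = G # Gs'" by (cases Gs) auto
  have "comp f (g # gs) xs = Option.bind (g xs) (\<lambda>y. comp (\<lambda>ys. f (y # ys)) gs xs)"
    by (auto simp: comp_def split: option.splits bind_splits)
  moreover have "reveals G (g xs)"
    using Cons.prems(2)[of 0] Gs by simp
  moreover have "reveals (\<lambda>s. if (\<Prod>G\<leftarrow>Gs'. G s) = 0 then 0
      else F (s # y # map (\<lambda>G. G s - 1) Gs')) (comp (\<lambda>ys. f (y # ys)) gs xs)" for y
    using Cons.IH[of Gs' "\<lambda>zs. F (hd zs # y # tl zs)" "\<lambda>ys. f (y # ys)"]
      Cons.prems(1) Cons.prems(2)[of "Suc _"] Cons.prems(3) Gs by (simp cong: if_cong)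
  ultimately have "reveals (\<lambda>s. if G s = 0 then 0 else if (\<Prod>G\<leftarrow>Gs'. G s) = 0 then 0
      else F (s # (G s - 1) # map (\<lambda>G. G s - 1) Gs')) (comp f (g # gs) xs)"
    using reveals_bind[where a = G and b = "\<lambda>s y. if (\<Prod>G\<leftarrow>Gs'. G s) = 0 then 0
      else F (s # y # map (\<lambda>G. G s - 1) Gs')"] by presburger
  then show ?case
    by (rule back_subst[where P = "\<lambda>a. reveals a _"]) (auto simp: Gs)
qed

text \<open>Search among the first \<open>n\<close> stage values for a zero of the approximated function, which shows
  as \<open>u i = 1\<close>. The state is 0 while all values seen are known to be nonzero (\<open>u i \<ge> 2\<close>), 1 once a
  value without an answer has been met, and \<open>Suc (Suc m)\<close> once the zero \<open>m\<close> has been found. The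
  predecessor of the state is thus again an approximation in the sense of \<open>reveals\<close>.\<close>

definition search :: "(nat \<Rightarrow> nat) \<Rightarrow> nat \<Rightarrow> nat" where
  "search u = rec_nat 0 (\<lambda>n y. if y = 0
     then if u n = 0 then 1 else if u n - 1 = 0 then Suc (Suc n) else 0
     else y)"

lemma search_eq_0: "search u n = 0 \<longleftrightarrow> (\<forall>i<n. 2 \<le> u i)"
  by (induction n) (auto simp: search_def less_Suc_eq)

lemma search_found: "search u n = Suc (Suc m) \<longleftrightarrow> m < n \<and> u m = 1 \<and> (\<forall>i<m. 2 \<le> u i)"
proof (induction n)
  case (Suc n)
  show ?case
  proof (cases "search u n = 0")
    case True
    then have "\<forall>i<n. 2 \<le> u i" by (simp add: search_eq_0)
    with True show ?thesis by (force simp: search_def less_Suc_eq)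
  next
    case False
    then have "\<exists>i<n. \<not> 2 \<le> u i" by (simp add: search_eq_0)
    moreover have "search u (Suc n) = search u n" using False by (simp add: search_def)
    ultimately show ?thesis using Suc.IH by (auto simp: less_Suc_eq)
  qed
qed (simp add: search_def)

text \<open>The stage serves both as the number of candidates searched and as the stage at which each of
  them is evaluated. If the minimisation has the value \<open>n\<close>, only the finitely many arguments up to
  \<open>n\<close> have to be answered permanently.\<close>

lemma reveals_minimise:
  assumes F: "\<And>n. reveals (\<lambda>s. F s n) (f (n # xs))"
  shows "reveals (\<lambda>s. search (F s) s - 1) (minimise f xs)"
  unfolding reveals_def
proof (intro conjI allI impI)
  fix s n assume "search (F s) s - 1 = Suc n"
  then have "search (F s) s = Suc (Suc n)" by simp
  then have n: "F s n = Suc 0" "\<forall>m<n. 2 \<le> F s m" by (auto simp: search_found)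
  have f0: "f (n # xs) = Some 0" using n(1) F unfolding reveals_def by blast
  have f1: "\<exists>y. f (m # xs) = Some (Suc y)" if "m < n" for m
  proof -
    have "2 \<le> F s m" using n(2) that by blast
    then have "F s m = Suc (Suc (F s m - 2))" by simp
    then show ?thesis using F unfolding reveals_def by blast
  qed
  have "(LEAST n. f (n # xs) = Some 0) = n"
    using f0 f1 by (intro Least_equality) (force simp: not_less[symmetric])+
  then show "minimise f xs = Some n" using f0 f1 unfolding minimise_def by auto
next
  fix n assume "minimise f xs = Some n"
  then obtain k where k: "f (k # xs) = Some 0" "\<forall>m<k. \<exists>y. f (m # xs) = Some (Suc y)"
      and n: "n = (LEAST n. f (n # xs) = Some 0)"
    unfolding minimise_def by (auto split: if_splits)
  have "n = k" unfolding n
    using k by (intro Least_equality) (force simp: not_less[symmetric])+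
  have "\<forall>\<^sub>F s in sequentially. F s n = 1"
    using F[of n] k(1) \<open>n = k\<close> unfolding reveals_def by auto
  moreover have "\<forall>\<^sub>F s in sequentially. \<forall>m\<in>{..<n}. 2 \<le> F s m"
  proof (rule eventually_ball_finite)
    show "\<forall>m\<in>{..<n}. \<forall>\<^sub>F s in sequentially. 2 \<le> F s m"
    proof
      fix m assume "m \<in> {..<n}"
      then obtain y where "f (m # xs) = Some (Suc y)" using k(2) \<open>n = k\<close> by auto
      then have "\<forall>\<^sub>F s in sequentially. F s m = Suc (Suc y)"
        using F[of m] unfolding reveals_def by auto
      then show "\<forall>\<^sub>F s in sequentially. 2 \<le> F s m" by eventually_elim auto
    qed
  qed simp
  moreover have "\<forall>\<^sub>F s in sequentially. n < s" by (rule eventually_gt_at_top)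
  ultimately show "\<forall>\<^sub>F s in sequentially. search (F s) s - 1 = Suc n"
  proof eventually_elim
    case (elim s)
    then have "search (F s) s = Suc (Suc n)" by (simp add: search_found)
    then show ?case by simp
  qed
qed

text \<open>The arity \<open>k\<close> is generalised in the induction because the parts of \<open>f\<close> are used at other
  arities. At arities where a basic function is undefined, the constant 0 approximates it.\<close>

lemma stage_approximation:
  assumes "partrec_in Orc f"
  shows "\<exists>F. recursive_in Orc (Suc k) F \<and> (\<forall>xs. length xs = k \<longrightarrow> reveals (\<lambda>s. F (s # xs)) (f xs))"
  using assms
proof (induction arbitrary: k)
  case zero
  show ?case
    by (rule exI[of _ "\<lambda>_. Suc 0"]) (simp add: recursive_const reveals_Some)
next
  case succ
  show ?case
  proof (cases "k = 1")
    case True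
    have "recursive_in Orc (Suc k) (\<lambda>ys. Suc (Suc (ys ! 1)))"
      unfolding True by (intro recursive_Suc recursive_args) auto
    then show ?thesis using True
      by (intro exI[of _ "\<lambda>ys. Suc (Suc (ys ! 1))"])
         (auto simp: length_Suc_conv unary_def reveals_Some)
  next
    case False
    then show ?thesis
      by (intro exI[of _ "\<lambda>_. 0"])
         (auto simp: recursive_const unary_def reveals_None split: list.splits)
  qed
next
  case (query h)
  show ?case
  proof (cases "k = 1")
    case True
    have "recursive_in Orc (Suc k) (\<lambda>ys. Suc (h (ys ! 1)))"
      unfolding True by (intro recursive_Suc recursive_query[OF query] recursive_args) auto
    then show ?thesis using True
      by (intro exI[of _ "\<lambda>ys. Suc (h (ys ! 1))"])
         (auto simp: length_Suc_conv unary_def reveals_Some)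
  next
    case False
    then show ?thesis
      by (intro exI[of _ "\<lambda>_. 0"])
         (auto simp: recursive_const unary_def reveals_None split: list.splits)
  qed
next
  case (proj i)
  show ?case
  proof (cases "i < k")
    case True
    then have "recursive_in Orc (Suc k) (\<lambda>ys. Suc (tl ys ! i))"
      by (intro recursive_Suc recursive_args) auto
    then show ?thesis using True
      by (intro exI[of _ "\<lambda>ys. Suc (tl ys ! i)"]) (auto simp: proj_def reveals_Some)
  next
    case False
    then show ?thesis
      by (intro exI[of _ "\<lambda>_. 0"]) (auto simp: recursive_const proj_def reveals_None)
  qed
next
  case (comp f gs)
  obtain F where F: "recursive_in Orc (Suc (length gs)) F"
      "\<And>ys. length ys = length gs \<Longrightarrow> reveals (\<lambda>s. F (s # ys)) (f ys)"
    using comp.IH(1)[of "length gs"] by blast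
  have "\<forall>g\<in>set gs. \<exists>G. recursive_in Orc (Suc k) G \<and>
      (\<forall>xs. length xs = k \<longrightarrow> reveals (\<lambda>s. G (s # xs)) (g xs))"
    using comp.IH(2) by blast
  then obtain G where G: "\<And>g. g \<in> set gs \<Longrightarrow> recursive_in Orc (Suc k) (G g)"
      "\<And>g xs. g \<in> set gs \<Longrightarrow> length xs = k \<Longrightarrow> reveals (\<lambda>s. G g (s # xs)) (g xs)"
    by metis
  let ?H = "\<lambda>ys. if (\<Prod>h\<leftarrow>map G gs. h ys) = 0 then 0
    else F (ys ! 0 # map (\<lambda>h. h ys) (map (\<lambda>g ys. G g ys - 1) gs))"
  have "recursive_vec_in Orc (Suc k) (length (map (\<lambda>g ys. G g ys - 1) gs))
      (\<lambda>ys. map (\<lambda>h. h ys) (map (\<lambda>g ys. G g ys - 1) gs))"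
    by (rule recursive_vec_map) (auto intro: recursive_pred[unfolded One_nat_def] G(1))
  then have v: "recursive_vec_in Orc (Suc k) (Suc (length gs))
      (\<lambda>ys. ys ! 0 # map (\<lambda>h. h ys) (map (\<lambda>g ys. G g ys - 1) gs))"
    by (intro recursive_args) auto
  have "recursive_in Orc (Suc k) ?H"
    by (intro recursive_if recursive_prod_list recursive_const recursive_comp[OF F(1) v])
       (auto intro: G(1))
  moreover have "reveals (\<lambda>s. ?H (s # xs)) (Defs.comp f gs xs)" if xs: "length xs = k" for xs
    using reveals_comp[of "map (\<lambda>g s. G g (s # xs)) gs" gs xs F f] G(2)[OF _ xs] F(2)
    by (simp add: o_def cong: if_cong)
  ultimately show ?case by blast
next
  case (prim_rec f g)
  show ?case
  proof (cases k)
    case 0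
    then show ?thesis
      by (intro exI[of _ "\<lambda>_. 0"]) (auto simp: recursive_const prim_rec_def reveals_None)
  next
    case (Suc k')
    obtain F where F: "recursive_in Orc (Suc k') F"
        "\<And>xs. length xs = k' \<Longrightarrow> reveals (\<lambda>s. F (s # xs)) (f xs)"
      using prim_rec.IH(1)[of k'] by blast
    obtain G where G: "recursive_in Orc (Suc (Suc (Suc k'))) G"
        "\<And>xs. length xs = Suc (Suc k') \<Longrightarrow> reveals (\<lambda>s. G (s # xs)) (g xs)"
      using prim_rec.IH(2)[of "Suc (Suc k')"] by blast
    let ?H = "\<lambda>zs. rec_nat (F (zs ! 0 # tl (tl zs)))
      (\<lambda>m y. if y = 0 then 0 else G (zs ! 0 # m # (y - 1) # tl (tl zs))) (tl zs ! 0)"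
    have F': "recursive_in Orc (Suc k) (\<lambda>zs. F (zs ! 0 # tl (tl zs)))"
      unfolding Suc by (rule recursive_comp[OF F(1)]; intro recursive_args) auto
    have G': "recursive_in Orc (Suc (Suc (Suc k)))
        (\<lambda>ys. G (tl (tl ys) ! 0 # ys ! 0 # (ys ! 1 - 1) # tl (tl (tl (tl ys)))))"
      unfolding Suc
      by (rule recursive_comp[OF G(1)]; intro recursive_args recursive_pred) auto
    have "recursive_in Orc (Suc k) ?H"
      by (intro recursive_rec_nat recursive_if recursive_const recursive_args F' G')
         (auto simp: Suc)
    moreover have "reveals (\<lambda>s. ?H (s # zs)) (Defs.prim_rec f g zs)" if zs: "length zs = k" for zs
    proof -
      obtain n xs where zs_eq: "zs = n # xs" and xs: "length xs = k'"
        using zs Suc by (cases zs) auto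
      have "reveals (\<lambda>s. rec_nat (F (s # xs))
          (\<lambda>m y. if y = 0 then 0 else G (s # m # (y - 1) # xs)) n) (prim_rec_aux f g n xs)" for n
      proof (induction n)
        case 0
        show ?case using F(2)[OF xs] by simp
      next
        case (Suc n)
        show ?case using reveals_bind[OF Suc.IH G(2)[of "n # _ # xs"]] xs by simp
      qed
      then show ?thesis by (simp add: zs_eq prim_rec_def cong: if_cong)
    qed
    ultimately show ?thesis by blast
  qed
next
  case (minimise f)
  obtain F where F: "recursive_in Orc (Suc (Suc k)) F"
      "\<And>xs. length xs = Suc k \<Longrightarrow> reveals (\<lambda>s. F (s # xs)) (f xs)"
    using minimise.IH[of "Suc k"] by blast
  let ?H = "\<lambda>zs. search (\<lambda>n. F (zs ! 0 # n # tl zs)) (zs ! 0) - 1"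
  have F': "recursive_in Orc (Suc (Suc (Suc k)))
      (\<lambda>ys. F (tl (tl ys) ! 0 # ys ! 0 # tl (tl (tl ys))))"
    by (rule recursive_comp[OF F(1)]; intro recursive_args) auto
  have "recursive_in Orc (Suc k) ?H"
    unfolding search_def
    by (intro recursive_rec_nat recursive_if recursive_const recursive_args recursive_pred
        recursive_Suc F') auto
  moreover have "reveals (\<lambda>s. ?H (s # xs)) (Defs.minimise f xs)" if xs: "length xs = k" for xs
    using reveals_minimise[of "\<lambda>s n. F (s # n # xs)" f xs] F(2)[of "_ # xs"] xs by simp
  ultimately show ?case by blast
qed

section \<open>The sets \<open>R\<^sub>n\<close> and their density\<close>

lemma Rk_iff: "m \<in> Rk n \<longleftrightarrow> (\<exists>j. m = 2 ^ n * (2 * j + 1))"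
proof
  assume "m \<in> Rk n"
  then have m: "2 ^ n dvd m" "\<not> 2 ^ (n + 1) dvd m" by (auto simp: Rk_def)
  from m(1) obtain c where c: "m = 2 ^ n * c" by blast
  then have "odd c" using m(2) by (auto simp: mult.commute)
  then show "\<exists>j. m = 2 ^ n * (2 * j + 1)" using c by (metis oddE)
next
  assume "\<exists>j. m = 2 ^ n * (2 * j + 1)"
  then obtain j where j: "m = 2 ^ n * (2 * j + 1)" by blast
  have "2 ^ (n + 1) dvd m \<longleftrightarrow> 2 ^ n * 2 dvd 2 ^ n * (2 * j + 1)"
    unfolding j by (simp only: power_add power_one_right)
  also have "\<dots> \<longleftrightarrow> 2 dvd 2 * j + 1" by (subst nat_mult_dvd_cancel1) auto
  finally show "m \<in> Rk n" using j by (simp add: Rk_def)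
qed

lemma Rk_unique: "m \<in> Rk n \<Longrightarrow> m \<in> Rk n' \<Longrightarrow> n = n'"
  unfolding Rk_def by (metis (mono_tags, lifting) Suc_eq_plus1 linorder_neqE_nat
      mem_Collect_eq power_le_dvd Suc_leI)

lemma mem_calR_iff: "m \<in> Rk n \<Longrightarrow> m \<in> calR A \<longleftrightarrow> n \<in> A"
  unfolding calR_def using Rk_unique by blast

text \<open>In an initial segment whose length is a multiple of \<open>2\<^sup>n\<^sup>+\<^sup>1\<close>, the set \<open>R\<^sub>n\<close> has a fraction
  \<open>2\<^sup>-\<^sup>(\<^sup>n\<^sup>+\<^sup>1\<^sup>)\<close> of the elements. Using only such segments avoids rounding.\<close>

lemma Rk_positive_density:
  "2 ^ Suc n * N = Suc M \<Longrightarrow> N \<le> card (Rk n \<inter> {0..M})"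
proof -
  assume N: "2 ^ Suc n * N = Suc M"
  let ?q = "\<lambda>j. 2 ^ n * (2 * j + 1) :: nat"
  have "?q j \<le> M" if "j < N" for j
  proof -
    have "?q j < 2 ^ n * (2 * (j + 1))" by simp
    also have "\<dots> \<le> 2 ^ n * (2 * N)" using that by (intro mult_le_mono) auto
    finally show ?thesis using N by simp
  qed
  then have "?q ` {..<N} \<subseteq> Rk n \<inter> {0..M}" by (auto simp: Rk_iff)
  then have "card (?q ` {..<N}) \<le> card (Rk n \<inter> {0..M})" by (intro card_mono) auto
  moreover have "card (?q ` {..<N}) = N" by (subst card_image) (auto simp: inj_on_def)
  ultimately show ?thesis by simp
qed

text \<open>If \<open>S\<close> missed \<open>R\<^sub>n\<close>, its relative size would be at most \<open>1 - 2\<^sup>-\<^sup>(\<^sup>n\<^sup>+\<^sup>1\<^sup>)\<close> on infinitely many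
  initial segments, which is incompatible with the limit 1.\<close>

lemma density_one_meets_Rk:
  assumes "has_density S 1"
  shows "S \<inter> Rk n \<noteq> {}"
proof
  assume disj: "S \<inter> Rk n = {}"
  define r where "r N = 2 ^ Suc n * Suc N - 1" for N :: nat
  have r: "Suc (r N) = 2 ^ Suc n * Suc N" for N by (simp add: r_def)
  have "strict_mono r"
    unfolding strict_mono_def using r
    by (metis Suc_less_eq mult_less_cancel1 zero_less_numeral zero_less_power)
  then have lim: "(\<lambda>N. real (card (S \<inter> {0..r N})) / real (r N + 1)) \<longlonglongrightarrow> 1"
    using LIMSEQ_subseq_LIMSEQ[OF assms[unfolded has_density_def]] by (simp add: o_def)
  have "real (card (S \<inter> {0..r N})) / real (r N + 1) \<le> 1 - 1 / 2 ^ Suc n" for N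
  proof -
    have "card (S \<inter> {0..r N}) + card (Rk n \<inter> {0..r N}) = card (S \<inter> {0..r N} \<union> Rk n \<inter> {0..r N})"
      using disj by (subst card_Un_disjoint) auto
    also have "\<dots> \<le> card {0..r N}" by (intro card_mono) auto
    also have "\<dots> = Suc (r N)" by simp
    finally have "card (S \<inter> {0..r N}) + Suc N \<le> Suc (r N)"
      using Rk_positive_density[OF r[symmetric, of N]] by linarith
    then have "real (card (S \<inter> {0..r N})) + real (Suc N) \<le> real (Suc (r N))"
      by (metis of_nat_add of_nat_le_iff)
    moreover have "real (Suc (r N)) = 2 ^ Suc n * real (Suc N)"
      unfolding r by (simp only: of_nat_mult of_nat_power of_nat_numeral)
    ultimately have "real (card (S \<inter> {0..r N})) / real (r N + 1)
        \<le> (2 ^ Suc n * real (Suc N) - real (Suc N)) / (2 ^ Suc n * real (Suc N))"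
      by (simp only: Suc_eq_plus1[symmetric]) (intro divide_right_mono; simp)
    also have "\<dots> = 1 - 1 / 2 ^ Suc n"
      by (simp add: diff_divide_distrib del: power_Suc of_nat_Suc)
    finally show ?thesis .
  qed
  then have "1 \<le> 1 - 1 / (2 :: real) ^ Suc n" by (intro LIMSEQ_le_const2[OF lim]) auto
  moreover have "0 < 1 / (2 :: real) ^ Suc n" by simp
  ultimately show False by linarith
qed

section \<open>Generic computability of \<open>\<R>(A)\<close>\<close>

text \<open>If \<open>m = 2\<^sup>n (2j + 1)\<close>, then \<open>n < m\<close> and \<open>j < m\<close>, so membership in \<open>\<R>(A)\<close> is a bounded search
  with one question to \<open>A\<close> for each candidate. It rejects \<open>m = 0\<close>, which is in no \<open>R\<^sub>n\<close>.\<close>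

lemma calR_reducible: "calR A \<le>\<^sub>T A"
proof -
  let ?O = "{indicator A :: nat \<Rightarrow> nat}"
  have indicator_eq: "indicator A x = (of_bool (x \<in> A) :: nat)" for x
    by (simp add: indicator_def)
  have ind: "recursive_in ?O k (\<lambda>xs. of_bool (n xs \<in> A))" if "recursive_in ?O k n" for k n
    using recursive_query[of "indicator A" ?O, OF insertI1 that] by (simp add: indicator_eq)
  have "recursive_in ?O (Suc 0) (\<lambda>xs. of_bool
      (\<exists>n<xs ! 0. \<exists>j<xs ! 0. n \<in> A \<and> xs ! 0 = 2 ^ n * (2 * j + 1)))"
    by (intro recursive_bounded_ex recursive_conj recursive_eq recursive_mult recursive_add
        recursive_power2 recursive_const ind recursive_args) auto
  moreover have "of_bool (\<exists>n<m. \<exists>j<m. n \<in> A \<and> m = 2 ^ n * (2 * j + 1)) = (indicator (calR A) m :: nat)"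
    for m
  proof -
    have "n < 2 ^ n * (2 * j + 1) \<and> j < 2 ^ n * (2 * j + 1)" for n j :: nat
    proof
      have "n < 2 ^ n * 1" by simp
      also have "\<dots> \<le> 2 ^ n * (2 * j + 1)" by (intro mult_le_mono) auto
      finally show "n < 2 ^ n * (2 * j + 1)" .
      have "j < 1 * (2 * j + 1)" by simp
      also have "\<dots> \<le> 2 ^ n * (2 * j + 1)" by (intro mult_le_mono) auto
      finally show "j < 2 ^ n * (2 * j + 1)" .
    qed
    then have "(\<exists>n<m. \<exists>j<m. n \<in> A \<and> m = 2 ^ n * (2 * j + 1)) \<longleftrightarrow> m \<in> calR A"
      unfolding calR_def UN_iff Rk_iff by blast
    then show ?thesis by (simp add: indicator_def)
  qed
  ultimately show ?thesis
    unfolding turing_reducible_def recursive_unary_iff by simp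
qed

lemma reducible_calR: "A \<le>\<^sub>T calR A"
proof -
  have "2 ^ n \<in> Rk n" for n by (auto simp: Rk_iff intro: exI[of _ 0])
  then have "2 ^ n \<in> calR A \<longleftrightarrow> n \<in> A" for n by (rule mem_calR_iff)
  then have "indicator A n = (indicator (calR A) (2 ^ n) :: nat)" for n
    by (simp add: indicator_def)
  moreover have "recursive_in {indicator (calR A)} (Suc 0) (\<lambda>xs. indicator (calR A) (2 ^ (xs ! 0)))"
    by (intro recursive_query[where h = "indicator (calR A)"] recursive_power2 recursive_args) auto
  ultimately show ?thesis
    unfolding turing_reducible_def recursive_unary_iff by simp
qed

lemma computable_generically_computable:
  assumes "computable_set S"
  shows "generically_computable S"
  unfolding generically_computable_def
proof (intro exI conjI)
  show "partial_computable (\<lambda>x. Some (indicator S x))"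
    using assms by (simp add: computable_set_def)
  have "has_density UNIV 1" unfolding has_density_def by simp
  then show "generic_description (\<lambda>x. Some (indicator S x)) S"
    by (auto simp: generic_description_def ran_def dom_def indicator_def)
qed

text \<open>All answers at points of \<open>R\<^sub>n\<close> agree, since each of them is the truth value of \<open>n \<in> A\<close>. The
  first stage with any answer therefore decides \<open>n \<in> A\<close>, and it does not matter which point the
  answer comes from.\<close>

lemma computable_of_generically_computable_calR:
  assumes "generically_computable (calR A)"
  shows "computable_set A"
proof -
  obtain \<Phi> where \<Phi>: "generic_description \<Phi> (calR A)" "partial_computable \<Phi>"
    using assms unfolding generically_computable_def by blast
  obtain f where f: "partrec_in {} f" "\<And>x. f [x] = \<Phi> x"
    using \<Phi>(2) unfolding partial_computable_def partial_computable_in_def by blast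
  obtain F where F: "recursive_in {} (Suc (Suc 0)) F"
      and F': "\<And>xs. length xs = Suc 0 \<Longrightarrow> reveals (\<lambda>s. F (s # xs)) (f xs)"
    using stage_approximation[OF f(1), of "Suc 0"] by blast
  have reveals: "reveals (\<lambda>s. F [s, m]) (\<Phi> m)" for m
    using F'[of "[m]"] by (simp add: f(2))
  let ?q = "\<lambda>n j. 2 ^ n * (2 * j + 1) :: nat"
  have sound: "F [s, ?q n j] = Suc y \<Longrightarrow> y = indicator A n" for s n j y
  proof -
    assume "F [s, ?q n j] = Suc y"
    then have "\<Phi> (?q n j) = Some y" using reveals unfolding reveals_def by blast
    then have "y = indicator (calR A) (?q n j)"
      using \<Phi>(1) unfolding generic_description_def by force
    moreover have "?q n j \<in> Rk n" using Rk_iff by blast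
    ultimately show ?thesis by (simp add: indicator_def mem_calR_iff)
  qed
  have found: "\<exists>t. \<exists>j<t. F [t, ?q n j] \<noteq> 0" for n
  proof -
    have "dom \<Phi> \<inter> Rk n \<noteq> {}"
      using \<Phi>(1) density_one_meets_Rk unfolding generic_description_def by blast
    then obtain j y where "\<Phi> (?q n j) = Some y" by (auto simp: Rk_iff)
    then have "\<forall>\<^sub>F s in sequentially. F [s, ?q n j] = Suc y"
      using reveals unfolding reveals_def by blast
    then have "\<forall>\<^sub>F s in sequentially. j < s \<and> F [s, ?q n j] \<noteq> 0"
      using eventually_gt_at_top[of j] by eventually_elim simp
    then show ?thesis using eventually_happens'[OF sequentially_bot] by fast
  qed
  define T where "T n = (LEAST t. \<exists>j<t. F [t, ?q n j] \<noteq> 0)" for n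
  have FF: "recursive_in {} k (\<lambda>xs. F [t xs, m xs])"
    if "recursive_in {} k t" "recursive_in {} k m" for k t m
    by (rule recursive_comp[OF F]) (intro recursive_args that)
  have T_rec: "recursive_in {} (Suc 0) (\<lambda>xs. T (xs ! 0))"
    unfolding T_def
    by (intro recursive_Least recursive_bounded_ex recursive_not recursive_eq FF recursive_mult
        recursive_add recursive_power2 recursive_const recursive_args found) auto
  have "recursive_in {} (Suc 0) (\<lambda>xs. of_bool (\<exists>j<T (xs ! 0). F [T (xs ! 0), ?q (xs ! 0) j] = 2))"
    by (intro recursive_bounded_ex recursive_eq FF recursive_mult
        recursive_add recursive_power2 recursive_const recursive_args T_rec
        recursive_weaken[OF T_rec]) auto
  \<comment> \<open>The value 2 is the answer 1, shifted by the successor that marks an answer.\<close>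
  moreover have "of_bool (\<exists>j<T n. F [T n, ?q n j] = 2) = (indicator A n :: nat)" for n
  proof -
    obtain j where j: "j < T n" "F [T n, ?q n j] \<noteq> 0"
      using LeastI_ex[OF found[of n]] unfolding T_def by blast
    then have "F [T n, ?q n j] = Suc (indicator A n)"
      using sound by (metis not0_implies_Suc)
    moreover have "n \<in> A" if "F [T n, ?q n i] = 2" for i
      using sound[of "T n" n i 1] that by (cases "n \<in> A") auto
    ultimately show ?thesis using j(1) by (cases "n \<in> A") auto
  qed
  ultimately show ?thesis
    unfolding computable_set_def partial_computable_def recursive_unary_iff by simp
qed

lemma noncomputable_of_nonzero_degree:
  assumes "d \<in> turing_degrees" "d \<noteq> zero_degree" "A \<in> d"
  shows "\<not> computable_set A"
proof
  assume A: "computable_set A"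
  have "A \<in> zero_degree" using A by (simp add: zero_degree_def)
  then show False
    using assms quotient_disj[OF equiv_turing, of d zero_degree] zero_degree_in_turing_degrees
    unfolding turing_degrees_def by blast
qed

theorem mainTheorem2:
  "(\<forall>A :: nat set. calR A \<equiv>\<^sub>T A \<and> (generically_computable (calR A) \<longleftrightarrow> computable_set A)) \<and>
   (\<forall>d \<in> turing_degrees. d \<noteq> zero_degree \<longrightarrow> (\<exists>S \<in> d. \<not> generically_computable S))"
proof (intro conjI allI ballI impI)
  fix A :: "nat set"
  show equiv: "calR A \<equiv>\<^sub>T A"
    by (simp add: turing_equivalent_def calR_reducible reducible_calR)
  show "generically_computable (calR A) \<longleftrightarrow> computable_set A"
    using computable_of_generically_computable_calR computable_generically_computable
      reducible_computable_set[OF calR_reducible] by blast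
next
  fix d assume d: "d \<in> turing_degrees" "d \<noteq> zero_degree"
  then obtain A where A: "d = {(A, B). A \<equiv>\<^sub>T B} `` {A}"
    unfolding turing_degrees_def by (auto elim: quotientE)
  have "calR A \<in> d" "A \<in> d"
    using A by (auto simp: turing_equivalent_def calR_reducible reducible_calR turing_reducible_refl)
  moreover have "\<not> generically_computable (calR A)"
    using noncomputable_of_nonzero_degree[OF d \<open>A \<in> d\<close>] computable_of_generically_computable_calR
    by blast
  ultimately show "\<exists>S\<in>d. \<not> generically_computable S" by blast
qed

end
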